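(* Let $\mathbf{Z}$ be a nonempty (finite or infinite) Borel space in which all singletons are measurable, and let $N\ge 1$ be an integer. For any measurable function $F:\mathbf{Z}^N\to[0,\infty)$, $$\mathbb{E}^{\mathrm{X}}(F)\le\frac{N^N}{N!}\,\mathbb{E}^{\mathrm{R}}(F).$$ Suppose, in addition, that $|\mathbf{Z}|\ge N$. Then the bound is tight and attained on a non-zero indicator function, i.e., there is a nonempty measurable set $B\subseteq\mathbf{Z}^N$ such that $\mathbb{E}^{\mathrm{X}}(1_B)=\frac{N^N}{N!}\mathbb{E}^{\mathrm{R}}(1_B)$. Moreover, there exists a measurable set $A\subseteq\mathbf{Z}^N$ such that $$\mathbb{P}^{\mathrm{R}}(A)=\frac{N!}{N^N}\le 1=\mathbb{P}^{\mathrm{X}}(A).$$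
   Context: A Borel space is a measurable space isomorphic to a Borel subset of $\mathbb{R}$. $\mathbf{Z}^N$ carries the product $\sigma$-algebra. A probability measure $R$ on $\mathbf{Z}^N$ is exchangeable if it is invariant under swapping any pair of coordinates (equivalently, under all permutations of the $N$ coordinates). $\mathfrak{P}(\mathbf{Z})$ is the set of all probability measures on $\mathbf{Z}$, and $Q^N$ is the $N$-fold product of $Q\in\mathfrak{P}(\mathbf{Z})$. For a measurable function $F:\mathbf{Z}^N\to[0,\infty)$ define, with values in $[0,\infty]$, $$\mathbb{E}^{\mathrm{X}}(F):=\sup_R\int F\,\mathrm{d}R,\qquad \mathbb{E}^{\mathrm{R}}(F):=\sup_{Q\in\mathfrak{P}(\mathbf{Z})}\int F\,\mathrm{d}Q^N,$$ where $R$ ranges over the exchangeable probability measures on $\mathbf{Z}^N$. For a measurable set $A\subseteq\mathbf{Z}^N$ define $$\mathbb{P}^{\mathrm{X}}(A):=\sup_R R(A),\qquad \mathbb{P}^{\mathrm{R}}(A):=\sup_{Q\in\mathfrak{P}(\mathbf{Z})}Q^N(A),$$ with $R$ again ranging over the exchangeable probability measures on $\mathbf{Z}^N$. $1_B$ denotes the indicator function of $B$. *)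

theory Defs
  imports "HOL-Probability.Probability"
begin

text \<open>A measurable space is represented by a value of type \<open>'a measure\<close>, of which only
  \<^const>\<open>space\<close> and \<^const>\<open>sets\<close> are used.\<close>

definition is_borel_space :: "'a measure \<Rightarrow> bool" where
  "is_borel_space Z \<longleftrightarrow>
     (\<exists>S \<in> sets (borel :: real measure).
        \<exists>f \<in> Z \<rightarrow>\<^sub>M restrict_space borel S. \<exists>g \<in> restrict_space borel S \<rightarrow>\<^sub>M Z.
          (\<forall>z \<in> space Z. g (f z) = z) \<and> (\<forall>s \<in> S. f (g s) = s))"

text \<open>Coordinates are indexed by \<open>0, \<dots>, N - 1\<close>. Applied to a probability
  measure \<open>Q\<close> this is the product measure; applied to a bare measurable space it supplies the
  product sigma-algebra.\<close>

abbreviation power_measure :: "'a measure \<Rightarrow> nat \<Rightarrow> (nat \<Rightarrow> 'a) measure" where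
  "power_measure M N \<equiv> PiM {..<N} (\<lambda>_. M)"

definition swap_coords :: "nat \<Rightarrow> nat \<Rightarrow> (nat \<Rightarrow> 'a) \<Rightarrow> (nat \<Rightarrow> 'a)" where
  "swap_coords i j z = z(i := z j, j := z i)"

definition exchangeable_measures :: "'a measure \<Rightarrow> nat \<Rightarrow> (nat \<Rightarrow> 'a) measure set" where
  "exchangeable_measures Z N =
     {R \<in> space (prob_algebra (power_measure Z N)).
        \<forall>i<N. \<forall>j<N. distr R (power_measure Z N) (swap_coords i j) = R}"

text \<open>The four suprema are taken in \<^typ>\<open>ennreal\<close>, so that they may be infinite.
  \<^term>\<open>space (prob_algebra Z)\<close> is the set of all probability measures on \<open>Z\<close>.\<close>

definition exch_expectation ::
  "'a measure \<Rightarrow> nat \<Rightarrow> ((nat \<Rightarrow> 'a) \<Rightarrow> real) \<Rightarrow> ennreal" where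
  "exch_expectation Z N F = (SUP R \<in> exchangeable_measures Z N. \<integral>\<^sup>+ z. ennreal (F z) \<partial>R)"

definition iid_expectation ::
  "'a measure \<Rightarrow> nat \<Rightarrow> ((nat \<Rightarrow> 'a) \<Rightarrow> real) \<Rightarrow> ennreal" where
  "iid_expectation Z N F =
     (SUP Q \<in> space (prob_algebra Z). \<integral>\<^sup>+ z. ennreal (F z) \<partial>power_measure Q N)"

definition exch_prob :: "'a measure \<Rightarrow> nat \<Rightarrow> (nat \<Rightarrow> 'a) set \<Rightarrow> ennreal" where
  "exch_prob Z N A = (SUP R \<in> exchangeable_measures Z N. emeasure R A)"

definition iid_prob :: "'a measure \<Rightarrow> nat \<Rightarrow> (nat \<Rightarrow> 'a) set \<Rightarrow> ennreal" where
  "iid_prob Z N A = (SUP Q \<in> space (prob_algebra Z). emeasure (power_measure Q N) A)"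

end

theory Submission
  imports Defs
begin

text \<open>Averaging an exchangeable \<open>R\<close> over the \<open>N!\<close> coordinate permutations leaves it unchanged. For a
  fixed point \<open>z\<close> with empirical distribution \<open>Q\<close>, the power \<open>Q\<^sup>N\<close> is the average of the point masses
  at \<open>z \<circ> g\<close> over all \<open>N\<^sup>N\<close> maps \<open>g\<close> of the index set into itself, so keeping only the permutations
  gives \<open>\<Sum>p. F (z \<circ> p) \<le> N\<^sup>N \<cdot> \<integral>F dQ\<^sup>N\<close>. Tightness is witnessed by the set of all
  rearrangements of a point with distinct coordinates: the uniform measure on it is exchangeable,
  while its \<open>Q\<^sup>N\<close>-mass is \<open>N!\<close> times a product of point masses, bounded by AM-GM.\<close>

section \<open>Coordinate permutations and exchangeable measures\<close>

text \<open>Points of the product space are \<open>undefined\<close> outside \<open>I\<close>, where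
  \<open>p\<close> is the identity. Hence plain composition stays extensional and agrees on the
  space with the restricted map, whose measurability is componentwise.\<close>

lemma measurable_comp_permutes:
  assumes "p permutes I"
  shows "(\<lambda>z. z \<circ> p) \<in> PiM I (\<lambda>_. M) \<rightarrow>\<^sub>M PiM I (\<lambda>_. M)"
proof -
  have "(\<lambda>z. \<lambda>i\<in>I. z (p i)) \<in> PiM I (\<lambda>_. M) \<rightarrow>\<^sub>M PiM I (\<lambda>_. M)"
    using permutes_in_image[OF assms]
    by (intro measurable_restrict measurable_component_singleton) auto
  moreover have "(\<lambda>i\<in>I. z (p i)) = z \<circ> p" if "z \<in> space (PiM I (\<lambda>_. M))" for z
    using that permutes_not_in[OF assms]
    by (auto simp: space_PiM PiE_def extensional_def restrict_def fun_eq_iff)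
  ultimately show ?thesis
    by (subst measurable_cong[where g = "\<lambda>z. \<lambda>i\<in>I. z (p i)"]) auto
qed

lemma swap_coords_eq_comp: "swap_coords i j z = z \<circ> Transposition.transpose i j"
  by (auto simp: swap_coords_def Transposition.transpose_def fun_eq_iff)

text \<open>Transpositions generate the symmetric group. The induction multiplies by one
  transposition \<open>t\<close> on the right at a time; since
  \<open>z \<circ> (q \<circ> t) = (z \<circ> q) \<circ> t\<close>, the new map is the old one
  followed by a coordinate swap.\<close>

lemma distr_exchangeable_permutes:
  assumes R: "R \<in> exchangeable_measures Z N" and p: "p permutes {..<N}"
  shows "distr R (power_measure Z N) (\<lambda>z. z \<circ> p) = R"
proof -
  let ?P = "power_measure Z N"
  have sR: "sets R = sets ?P"
    and invariant: "\<And>i j. i < N \<Longrightarrow> j < N \<Longrightarrow> distr R ?P (swap_coords i j) = R"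
    using R by (auto simp: exchangeable_measures_def space_prob_algebra)
  have mR: "f \<in> R \<rightarrow>\<^sub>M ?P" if "f \<in> ?P \<rightarrow>\<^sub>M ?P" for f
    using that measurable_cong_sets[OF sR refl] by blast
  from finite_lessThan p show ?thesis
  proof (induction p rule: permutes_rev_induct)
    case id
    show ?case
      using distr_id2[of ?P R] sR by (simp add: id_def comp_def)
  next
    case (swap a b q)
    have t: "swap_coords a b \<in> ?P \<rightarrow>\<^sub>M ?P"
      using swap.hyps measurable_comp_permutes[OF permutes_swap_id[of a "{..<N}" b], of Z]
      by (simp add: swap_coords_eq_comp[abs_def])
    have "distr R ?P (\<lambda>z. z \<circ> (q \<circ> Transposition.transpose a b))
        = distr (distr R ?P (\<lambda>z. z \<circ> q)) ?P (swap_coords a b)"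
      using t measurable_comp_permutes[OF swap.hyps(4)]
      by (subst distr_distr[OF t mR]) (auto simp: swap_coords_eq_comp comp_def)
    also have "\<dots> = R"
      unfolding swap.IH using invariant swap.hyps by simp
    finally show ?case .
  qed
qed

section \<open>Point masses in integrals and in product measures\<close>

text \<open>The simple function that equals \<open>f\<close> on \<open>S\<close> and 0 elsewhere
  lies below \<open>f\<close>. This is the step that later discards all index maps except the
  permutations.\<close>

lemma nn_integral_ge_sum_points:
  fixes f :: "'a \<Rightarrow> ennreal"
  assumes "finite S" "\<And>x. x \<in> S \<Longrightarrow> {x} \<in> sets M"
  shows "(\<Sum>x\<in>S. f x * emeasure M {x}) \<le> (\<integral>\<^sup>+ x. f x \<partial>M)"
proof -
  have "(\<Sum>x\<in>S. f x * emeasure M {x}) = (\<Sum>x\<in>S. \<integral>\<^sup>+ y. f x * indicator {x} y \<partial>M)"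
    using assms by (simp add: nn_integral_cmult_indicator)
  also have "\<dots> = (\<integral>\<^sup>+ y. (\<Sum>x\<in>S. f x * indicator {x} y) \<partial>M)"
    using assms by (intro nn_integral_sum[symmetric]) auto
  also have "\<dots> \<le> (\<integral>\<^sup>+ y. f y \<partial>M)"
  proof (rule nn_integral_mono)
    fix y
    have "(\<Sum>x\<in>S. f x * indicator {x} y) = (\<Sum>x\<in>S. if x = y then f y else 0)"
      by (intro sum.cong) (auto simp: indicator_def)
    then show "(\<Sum>x\<in>S. f x * indicator {x} y) \<le> f y"
      using assms by simp
  qed
  finally show ?thesis .
qed

lemma emeasure_PiM_point:
  assumes "finite I" "\<And>i. i \<in> I \<Longrightarrow> prob_space (M i)"
    and "x \<in> extensional I" "\<And>i. i \<in> I \<Longrightarrow> {x i} \<in> sets (M i)"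
  shows "{x} \<in> sets (PiM I M)"
    and "emeasure (PiM I M) {x} = (\<Prod>i\<in>I. emeasure (M i) {x i})"
proof -
  \<comment> \<open>\<open>product_prob_space\<close> asks for a probability measure at every index,
    so the family is completed outside \<open>I\<close> by a point mass; the product over
    \<open>I\<close> does not change.\<close>
  define M' where "M' i = (if i \<in> I then M i else return (count_space UNIV) undefined)" for i
  have eq: "PiM I M = PiM I M'" by (intro PiM_cong) (auto simp: M'_def)
  interpret product_prob_space M' I
    using assms(2) by (intro product_prob_spaceI) (auto simp: M'_def intro!: prob_space_return)
  have x: "{x} = (\<Pi>\<^sub>E i\<in>I. {x i})"
    using assms(3) PiE_singleton by metis
  show "{x} \<in> sets (PiM I M)"
    unfolding x using assms by (intro sets_PiM_I_finite)
  have "emeasure (PiM I M') {x} = (\<Prod>i\<in>I. emeasure (M' i) {x i})"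
    unfolding x using assms by (intro emeasure_PiM) (auto simp: M'_def)
  then show "emeasure (PiM I M) {x} = (\<Prod>i\<in>I. emeasure (M i) {x i})"
    by (simp add: eq M'_def)
qed

section \<open>Empirical measures and the upper bound\<close>

text \<open>As a pushforward from the index set it pools the mass of equal coordinates
  automatically, and its power becomes a pushforward of the uniform measure on index maps.\<close>

definition empirical_measure :: "'a measure \<Rightarrow> nat \<Rightarrow> (nat \<Rightarrow> 'a) \<Rightarrow> 'a measure" where
  "empirical_measure Z N z = distr (uniform_count_measure {..<N}) Z z"

lemma measurable_coordinates:
  assumes "z \<in> space (power_measure Z N)"
  shows "z \<in> uniform_count_measure {..<N} \<rightarrow>\<^sub>M Z"
  using assms
  by (auto simp: measurable_def space_uniform_count_measure sets_uniform_count_measure space_PiM)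

lemma prob_space_uniform_lessThan: "N \<ge> 1 \<Longrightarrow> prob_space (uniform_count_measure {..<N::nat})"
  by (intro prob_space_uniform_count_measure) (auto simp: lessThan_empty_iff)

lemma empirical_measure_in_prob_algebra:
  assumes "N \<ge> 1" "z \<in> space (power_measure Z N)"
  shows "empirical_measure Z N z \<in> space (prob_algebra Z)"
  unfolding empirical_measure_def space_prob_algebra
  using prob_space.prob_space_distr[OF prob_space_uniform_lessThan measurable_coordinates] assms
  by simp

text \<open>Drawing \<open>N\<close> indices independently and uniformly gives each index map
  probability \<open>(1 / N) ^ N\<close>, and the sum keeps only the maps that are permutations.
  Counting index maps rather than points \<open>z \<circ> p\<close> lets coordinates of
  \<open>z\<close> coincide.\<close>

lemma sum_permutes_le_empirical:
  fixes f :: "(nat \<Rightarrow> 'a) \<Rightarrow> ennreal"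
  assumes N: "N \<ge> 1" and z: "z \<in> space (power_measure Z N)"
    and f: "f \<in> borel_measurable (power_measure Z N)"
  shows "(\<Sum>p | p permutes {..<N}. f (z \<circ> p)) * ennreal ((1 / N) ^ N)
           \<le> (\<integral>\<^sup>+ x. f x \<partial>power_measure (empirical_measure Z N z) N)"
proof -
  let ?I = "{..<N}" and ?S = "{p. p permutes {..<N}}"
  let ?U = "uniform_count_measure ?I" and ?Q = "empirical_measure Z N z"
  note U = prob_space_uniform_lessThan[OF N] and mz = measurable_coordinates[OF z]
  have mz': "z \<in> ?U \<rightarrow>\<^sub>M ?Q"
    using mz by (simp add: empirical_measure_def)
  have Q: "prob_space ?Q"
    using empirical_measure_in_prob_algebra[OF N z] by (simp add: space_prob_algebra)
  \<comment> \<open>The power of a pushforward is the pushforward of the power: a sample from the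
    power of \<open>?Q\<close> is \<open>z\<close> composed with a uniformly random index
    map.\<close>
  have eq: "power_measure ?Q N = distr (power_measure ?U N) (power_measure ?Q N) (compose ?I z)"
    using distr_PiM_finite_prob_space'[of ?I "\<lambda>_. ?U" "\<lambda>_. ?Q" z] U Q mz'
    by (simp add: empirical_measure_def distr_distr cong: distr_cong)
  have sets_Q: "sets (power_measure ?Q N) = sets (power_measure Z N)"
    by (intro sets_PiM_cong) (auto simp: empirical_measure_def)
  have m_compose: "compose ?I z \<in> power_measure ?U N \<rightarrow>\<^sub>M power_measure ?Q N"
    unfolding compose_def
    by (intro measurable_restrict measurable_compose[OF _ mz'] measurable_component_singleton)
  have f': "f \<in> borel_measurable (power_measure ?Q N)"
    using f measurable_cong_sets[OF sets_Q refl] by blast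
  \<comment> \<open>A permutation is the identity outside \<open>?I\<close>, whereas an index map in
    the product space is \<open>undefined\<close> there; hence the detour through
    \<open>restrict p ?I\<close>.\<close>
  have compose_restrict: "compose ?I z (restrict p ?I) = z \<circ> p" if "p permutes ?I" for p
    using that z permutes_not_in[OF that] permutes_in_image[OF that]
    by (auto simp: compose_def fun_eq_iff space_PiM PiE_def extensional_def)
  have inj: "inj_on (\<lambda>p. restrict p ?I) ?S"
  proof (rule inj_onI)
    fix p q assume pq: "p \<in> ?S" "q \<in> ?S" "restrict p ?I = restrict q ?I"
    show "p = q"
    proof
      fix i show "p i = q i"
        using pq(1,2) fun_cong[OF pq(3), of i]
        by (cases "i \<in> ?I") (simp_all add: permutes_not_in del: lessThan_iff)
    qed
  qed
  have point: "{restrict p ?I} \<in> sets (power_measure ?U N)"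
    "emeasure (power_measure ?U N) {restrict p ?I} = ennreal ((1 / N) ^ N)"
    if "p \<in> ?S" for p
  proof -
    have *: "{restrict p ?I i} \<in> sets ?U" "emeasure ?U {restrict p ?I i} = ennreal (1 / N)"
      if "i \<in> ?I" for i
      using that \<open>p \<in> ?S\<close> permutes_in_image[of p ?I i]
      by (auto simp: sets_uniform_count_measure emeasure_uniform_count_measure)
    show "{restrict p ?I} \<in> sets (power_measure ?U N)"
      using * U by (intro emeasure_PiM_point) auto
    have "emeasure (power_measure ?U N) {restrict p ?I} = (\<Prod>i\<in>?I. emeasure ?U {restrict p ?I i})"
      using * U by (intro emeasure_PiM_point) auto
    also have "\<dots> = ennreal ((1 / N) ^ N)"
      using * by (simp add: ennreal_power del: restrict_apply restrict_apply')
    finally show "emeasure (power_measure ?U N) {restrict p ?I} = ennreal ((1 / N) ^ N)" .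
  qed
  have "(\<Sum>p\<in>?S. f (z \<circ> p)) * ennreal ((1 / N) ^ N)
      = (\<Sum>p\<in>?S. f (compose ?I z (restrict p ?I)) * emeasure (power_measure ?U N) {restrict p ?I})"
    unfolding sum_distrib_right by (intro sum.cong refl) (simp add: point compose_restrict)
  also have "\<dots> = (\<Sum>g\<in>(\<lambda>p. restrict p ?I) ` ?S.
      f (compose ?I z g) * emeasure (power_measure ?U N) {g})"
    by (simp add: sum.reindex[OF inj])
  also have "\<dots> \<le> (\<integral>\<^sup>+ g. f (compose ?I z g) \<partial>power_measure ?U N)"
    using point by (intro nn_integral_ge_sum_points) (auto simp: finite_permutations)
  also have "\<dots> = (\<integral>\<^sup>+ x. f x \<partial>power_measure ?Q N)"
    by (subst eq, subst nn_integral_distr[OF m_compose]) (use f' in auto)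
  finally show ?thesis .
qed

text \<open>By invariance, \<open>N!\<close> times the integral of \<open>F\<close> under
  \<open>R\<close> is the integral of its sum over all permutations. That sum is at most
  \<open>N^N\<close> times the i.i.d. supremum at every point, because the empirical measure of the
  point competes in the supremum, and \<open>R\<close> has total mass 1.\<close>

lemma exch_expectation_le:
  assumes N: "N \<ge> 1" and F: "F \<in> borel_measurable (power_measure Z N)"
  shows "exch_expectation Z N F \<le> ennreal (real N ^ N / fact N) * iid_expectation Z N F"
  unfolding exch_expectation_def
proof (rule SUP_least)
  let ?S = "{p. p permutes {..<N}}"
  define f where "f z = ennreal (F z)" for z
  define c where "c = iid_expectation Z N F"
  fix R assume R: "R \<in> exchangeable_measures Z N"
  have sR: "sets R = sets (power_measure Z N)" and "prob_space R"
    using R by (auto simp: exchangeable_measures_def space_prob_algebra)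
  interpret R: prob_space R by fact
  have spR: "space R = space (power_measure Z N)"
    using sR by (rule sets_eq_imp_space_eq)
  have f: "f \<in> borel_measurable (power_measure Z N)"
    unfolding f_def using F by measurable
  have mp: "(\<lambda>z. z \<circ> p) \<in> R \<rightarrow>\<^sub>M power_measure Z N" if "p \<in> ?S" for p
    using measurable_comp_permutes[of p "{..<N}" Z] that measurable_cong_sets[OF sR refl] by blast
  have perm: "(\<integral>\<^sup>+ z. f (z \<circ> p) \<partial>R) = (\<integral>\<^sup>+ z. f z \<partial>R)" if "p \<in> ?S" for p
  proof -
    have "(\<integral>\<^sup>+ z. f (z \<circ> p) \<partial>R) = (\<integral>\<^sup>+ z. f z \<partial>distr R (power_measure Z N) (\<lambda>z. z \<circ> p))"
      using f by (intro nn_integral_distr[OF mp[OF that], symmetric]) simp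
    then show ?thesis
      using distr_exchangeable_permutes[OF R, of p] that by simp
  qed
  have bound: "(\<Sum>p\<in>?S. f (z \<circ> p)) \<le> ennreal (real N ^ N) * c" if "z \<in> space R" for z
  proof -
    have "(\<Sum>p\<in>?S. f (z \<circ> p)) * ennreal ((1 / N) ^ N) \<le> c"
      unfolding c_def iid_expectation_def
      using that spR sum_permutes_le_empirical[OF N _ f, of z]
      by (intro SUP_upper2[OF empirical_measure_in_prob_algebra[OF N, of z]]) (simp_all add: f_def)
    \<comment> \<open>\<open>c\<close> may be infinite, so constants are moved across the inequality
      by multiplying with finite reciprocals; the factor \<open>fact N\<close> is treated in the
      same way below.\<close>
    then have "ennreal (real N ^ N) * ((\<Sum>p\<in>?S. f (z \<circ> p)) * ennreal ((1 / N) ^ N))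
        \<le> ennreal (real N ^ N) * c"
      by (intro mult_left_mono) auto
    moreover have "ennreal (real N ^ N) * (x * ennreal ((1 / N) ^ N)) = x" for x
    proof -
      have "ennreal (real N ^ N) * ennreal ((1 / N) ^ N) = 1"
        using N by (simp add: ennreal_mult'[symmetric] power_one_over)
      then show ?thesis by (metis mult.left_commute mult.right_neutral)
    qed
    ultimately show ?thesis by simp
  qed
  have "ennreal (fact N) * (\<integral>\<^sup>+ z. f z \<partial>R) = (\<Sum>p\<in>?S. \<integral>\<^sup>+ z. f (z \<circ> p) \<partial>R)"
    by (simp add: perm card_permutations ennreal_of_nat_eq_real_of_nat)
  also have "\<dots> = (\<integral>\<^sup>+ z. (\<Sum>p\<in>?S. f (z \<circ> p)) \<partial>R)"
    using measurable_compose[OF mp f] by (intro nn_integral_sum[symmetric])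
  also have "\<dots> \<le> (\<integral>\<^sup>+ z. ennreal (real N ^ N) * c \<partial>R)"
    using bound by (intro nn_integral_mono)
  finally have "ennreal (fact N) * (\<integral>\<^sup>+ z. f z \<partial>R) \<le> ennreal (real N ^ N) * c"
    by (simp add: R.emeasure_space_1)
  then have "ennreal (1 / fact N) * (ennreal (fact N) * (\<integral>\<^sup>+ z. f z \<partial>R))
      \<le> ennreal (1 / fact N) * (ennreal (real N ^ N) * c)"
    by (intro mult_left_mono) auto
  then show "(\<integral>\<^sup>+ z. ennreal (F z) \<partial>R) \<le> ennreal (real N ^ N / fact N) * iid_expectation Z N F"
    unfolding mult.assoc[symmetric]
    by (simp add: ennreal_mult'[symmetric] f_def[symmetric] c_def[symmetric])
qed

section \<open>The orbit of a point and the uniform law on its rearrangements\<close>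

definition rearrangements :: "nat \<Rightarrow> (nat \<Rightarrow> 'a) \<Rightarrow> (nat \<Rightarrow> 'a) set" where
  "rearrangements N z = (\<lambda>p. z \<circ> p) ` {p. p permutes {..<N}}"

lemma finite_rearrangements: "finite (rearrangements N z)"
  by (simp add: rearrangements_def finite_permutations)

lemma comp_permutes_in_space:
  assumes "z \<in> space (power_measure Z N)" "p permutes {..<N}"
  shows "z \<circ> p \<in> space (power_measure Z N)"
  using measurable_space[OF measurable_comp_permutes[OF assms(2)] assms(1)] .

lemma rearrangements_subset_space:
  assumes "z \<in> space (power_measure Z N)"
  shows "rearrangements N z \<subseteq> space (power_measure Z N)"
  unfolding rearrangements_def using comp_permutes_in_space[OF assms] by blast

lemma singleton_in_sets_power:
  assumes "\<forall>z\<in>space Z. {z} \<in> sets Z" "x \<in> space (power_measure Z N)"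
  shows "{x} \<in> sets (power_measure Z N)"
proof -
  have x: "{x} = (\<Pi>\<^sub>E i\<in>{..<N}. {x i})"
    using assms(2) PiE_singleton[of x "{..<N}"] by (auto simp: space_PiM PiE_def)
  show ?thesis
    unfolding x using assms by (intro sets_PiM_I_finite) (auto simp: space_PiM)
qed

lemma rearrangements_in_sets:
  assumes "\<forall>z\<in>space Z. {z} \<in> sets Z" "z \<in> space (power_measure Z N)"
  shows "rearrangements N z \<in> sets (power_measure Z N)"
proof (rule sets.countable)
  show "countable (rearrangements N z)"
    using finite_rearrangements by (rule countable_finite)
  show "{x} \<in> sets (power_measure Z N)" if "x \<in> rearrangements N z" for x
    using assms(1) subsetD[OF rearrangements_subset_space[OF assms(2)] that]
    by (rule singleton_in_sets_power)
qed

text \<open>Swapping two coordinates of \<open>z \<circ> p\<close> replaces \<open>p\<close> by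
  \<open>p \<circ> ?t\<close>, and right multiplication by \<open>?t\<close> is a bijection of the
  permutations, so it preserves their uniform law. The default value \<open>z\<close> keeps the map
  inside the space on the whole function type.\<close>

lemma uniform_rearrangement_exchangeable:
  assumes z: "z \<in> space (power_measure Z N)"
  shows "distr (measure_pmf (pmf_of_set {p. p permutes {..<N}})) (power_measure Z N)
           (\<lambda>p. if p permutes {..<N} then z \<circ> p else z) \<in> exchangeable_measures Z N"
    (is "distr ?U ?P ?h \<in> _")
  unfolding exchangeable_measures_def
proof (intro CollectI conjI allI impI)
  have h: "?h p \<in> space ?P" for p
    using comp_permutes_in_space[OF z] z by simp
  have mh: "?h \<in> ?U \<rightarrow>\<^sub>M ?P"
    unfolding measurable_pmf_measure1 by (rule Pi_I) (rule h)
  show "distr ?U ?P ?h \<in> space (prob_algebra ?P)"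
    using measure_pmf.prob_space_distr[OF mh] by (simp add: space_prob_algebra)
  have mh': "?h \<in> count_space UNIV \<rightarrow>\<^sub>M ?P"
    unfolding measurable_count_space_eq1 by (rule Pi_I) (rule h)
  fix i j assume ij: "i < N" "j < N"
  let ?t = "Transposition.transpose i j"
  have t: "?t permutes {..<N}"
    using ij by (intro permutes_swap_id) auto
  have mt: "swap_coords i j \<in> ?P \<rightarrow>\<^sub>M ?P"
    using measurable_comp_permutes[OF t, of Z] by (simp add: swap_coords_eq_comp[abs_def])
  have closed: "p \<circ> ?t permutes {..<N} \<longleftrightarrow> p permutes {..<N}" for p
  proof
    assume "p \<circ> ?t permutes {..<N}"
    from permutes_compose[OF t this] show "p permutes {..<N}" by (simp add: comp_assoc)
  qed (rule permutes_compose[OF t])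
  have set_U: "set_pmf (pmf_of_set {p. p permutes {..<N}}) = {p. p permutes {..<N}}"
    by (intro set_pmf_of_set finite_permutations) (use permutes_id in blast)+
  \<comment> \<open>Where \<open>p\<close> is not a permutation, the default value \<open>z\<close>
    need not be fixed by the swap, so the identity is claimed only almost everywhere.\<close>
  have swap_h: "AE p in ?U. swap_coords i j (?h p) = ?h (p \<circ> ?t)"
    by (simp add: AE_measure_pmf_iff set_U closed swap_coords_eq_comp comp_assoc)
  have m_shift: "(\<lambda>p. p \<circ> ?t) \<in> ?U \<rightarrow>\<^sub>M count_space UNIV"
    by simp
  have bij: "bij_betw (\<lambda>p. p \<circ> ?t) {p. p permutes {..<N}} {p. p permutes {..<N}}"
    by (rule bij_betwI[where g = "\<lambda>p. p \<circ> ?t"]) (auto simp: closed comp_assoc)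
  have "distr (distr ?U ?P ?h) ?P (swap_coords i j) = distr ?U ?P (\<lambda>p. swap_coords i j (?h p))"
    by (subst distr_distr[OF mt mh]) (simp add: comp_def)
  also have "\<dots> = distr ?U ?P (\<lambda>p. ?h (p \<circ> ?t))"
  proof (rule distr_cong_AE)
    show "(\<lambda>p. swap_coords i j (?h p)) \<in> ?U \<rightarrow>\<^sub>M ?P"
      using mh mt by (rule measurable_compose)
    show "(\<lambda>p. ?h (p \<circ> ?t)) \<in> ?U \<rightarrow>\<^sub>M ?P"
      using m_shift mh' by (rule measurable_compose)
  qed (use swap_h in simp_all)
  also have "\<dots> = distr (distr ?U (count_space UNIV) (\<lambda>p. p \<circ> ?t)) ?P ?h"
    by (subst distr_distr[OF mh' m_shift]) (simp only: comp_def)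
  also have "distr ?U (count_space UNIV) (\<lambda>p. p \<circ> ?t)
      = measure_pmf (map_pmf (\<lambda>p. p \<circ> ?t) (pmf_of_set {p. p permutes {..<N}}))"
    by (simp add: map_pmf_rep_eq)
  also have "map_pmf (\<lambda>p. p \<circ> ?t) (pmf_of_set {p. p permutes {..<N}})
      = pmf_of_set {p. p permutes {..<N}}"
    by (intro map_pmf_of_set_bij_betw bij finite_permutations) (use permutes_id in blast)+
  finally show "distr (distr ?U ?P ?h) ?P (swap_coords i j) = distr ?U ?P ?h" .
qed

lemma exch_prob_rearrangements:
  assumes sing: "\<forall>z\<in>space Z. {z} \<in> sets Z" and z: "z \<in> space (power_measure Z N)"
  shows "exch_prob Z N (rearrangements N z) = 1"
proof (rule antisym)
  show "exch_prob Z N (rearrangements N z) \<le> 1"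
    unfolding exch_prob_def
    by (intro SUP_least prob_space.measure_le_1)
       (simp add: exchangeable_measures_def space_prob_algebra)
next
  let ?P = "power_measure Z N" and ?U = "measure_pmf (pmf_of_set {p. p permutes {..<N}})"
  let ?h = "\<lambda>p. if p permutes {..<N} then z \<circ> p else z"
  have h: "?h p \<in> space ?P" for p
    using comp_permutes_in_space[OF z] z by simp
  have mh: "?h \<in> ?U \<rightarrow>\<^sub>M ?P"
    unfolding measurable_pmf_measure1 by (rule Pi_I) (rule h)
  \<comment> \<open>\<open>z\<close> is the default value of \<open>?h\<close>; since it lies in the
    orbit too, the preimage of the orbit is the whole type.\<close>
  have "z \<in> rearrangements N z"
    unfolding rearrangements_def by (rule image_eqI[of _ _ id]) (simp_all add: permutes_id)
  moreover have "z \<circ> p \<in> rearrangements N z" if "p permutes {..<N}" for p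
    using that by (simp add: rearrangements_def)
  ultimately have "?h -` rearrangements N z = UNIV"
    by auto
  then have "emeasure (distr ?U ?P ?h) (rearrangements N z) = 1"
    unfolding emeasure_distr[OF mh rearrangements_in_sets[OF sing z]]
    using measure_pmf.emeasure_space_1 by simp
  then show "1 \<le> exch_prob Z N (rearrangements N z)"
    unfolding exch_prob_def
    by (intro SUP_upper2[OF uniform_rearrangement_exchangeable[OF z]]) (rule eq_refl[OF sym])
qed

section \<open>The i.i.d. probability of an orbit, by AM-GM\<close>

text \<open>AM-GM with the root cleared. The sum is only bounded by 1, as a measure \<open>Q\<close>
  may also charge points that are not coordinates of \<open>z\<close>.\<close>

lemma prod_le_power_mean:
  fixes x :: "'i \<Rightarrow> real"
  assumes "finite S" "\<And>i. i \<in> S \<Longrightarrow> x i \<ge> 0" "sum x S \<le> 1"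
  shows "prod x S \<le> (1 / card S) ^ card S"
proof (cases "S = {}")
  case False
  let ?n = "card S"
  have n: "?n > 0" using False assms(1) by (simp add: card_gt_0_iff)
  have P: "prod x S \<ge> 0" using assms(2) by (rule prod_nonneg)
  have "prod x S powr (1 / ?n) \<le> (\<Sum>i\<in>S. x i / ?n)"
    using assms(1) False assms(2) by (rule arith_geom_mean)
  also have "\<dots> = sum x S / ?n"
    by (rule sum_divide_distrib[symmetric])
  also have "\<dots> \<le> 1 / ?n"
    using assms(3) by (rule divide_right_mono) simp
  finally have "(prod x S powr (1 / ?n)) ^ ?n \<le> (1 / ?n) ^ ?n"
    by (rule power_mono) simp
  moreover have "(prod x S powr (1 / ?n)) ^ ?n = prod x S"
    using n P by (cases "prod x S = 0") (simp_all add: powr_power)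
  ultimately show ?thesis by simp
qed simp

text \<open>All rearrangements of \<open>z\<close> have the same mass, the product of the
  \<open>Q\<close>-masses of its coordinates. Injectivity makes these coordinates disjoint atoms of
  total mass at most 1, so AM-GM bounds the product.\<close>

lemma iid_prob_rearrangements_le:
  assumes sing: "\<forall>z\<in>space Z. {z} \<in> sets Z" and z: "z \<in> space (power_measure Z N)"
    and inj: "inj_on z {..<N}"
  shows "iid_prob Z N (rearrangements N z) \<le> ennreal (fact N / real N ^ N)"
  unfolding iid_prob_def
proof (rule SUP_least)
  let ?I = "{..<N}"
  fix Q assume "Q \<in> space (prob_algebra Z)"
  then have sQ: "sets Q = sets Z" and "prob_space Q"
    by (auto simp: space_prob_algebra)
  interpret Q: prob_space Q by fact
  have zi: "{z i} \<in> sets Q" if "i < N" for i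
    using that z sing sQ by (auto simp: space_PiM)
  have "(\<Sum>i\<in>?I. measure Q {z i}) = measure Q (\<Union>i\<in>?I. {z i})"
    using zi inj
    by (intro Q.finite_measure_finite_Union[symmetric]) (auto simp: disjoint_family_on_def inj_on_def)
  also have "\<dots> \<le> 1" by (rule Q.prob_le_1)
  finally have amgm: "(\<Prod>i\<in>?I. measure Q {z i}) \<le> (1 / N) ^ N"
    using prod_le_power_mean[of ?I "\<lambda>i. measure Q {z i}"] by simp
  have point: "{y} \<in> sets (power_measure Q N)"
    "emeasure (power_measure Q N) {y} \<le> ennreal ((1 / N) ^ N)"
    if y: "y \<in> rearrangements N z" for y
  proof -
    from y obtain p where p: "p permutes ?I" and yp: "y = z \<circ> p"
      by (auto simp: rearrangements_def)
    have ext: "y \<in> extensional ?I"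
      using y rearrangements_subset_space[OF z] by (auto simp: space_PiM PiE_def)
    have yi: "{y i} \<in> sets Q" if "i \<in> ?I" for i
      using that zi permutes_in_image[OF p, of i] by (simp add: yp)
    show "{y} \<in> sets (power_measure Q N)"
      using ext yi Q.prob_space_axioms by (intro emeasure_PiM_point) auto
    have "emeasure (power_measure Q N) {y} = (\<Prod>i\<in>?I. emeasure Q {y i})"
      using ext yi Q.prob_space_axioms by (intro emeasure_PiM_point) auto
    also have "\<dots> = (\<Prod>i\<in>?I. emeasure Q {z i})"
      using prod.permute[OF p, of "\<lambda>i. emeasure Q {z i}"] by (simp add: yp comp_def)
    also have "\<dots> = ennreal (\<Prod>i\<in>?I. measure Q {z i})"
      by (simp add: Q.emeasure_eq_measure prod_ennreal)
    also have "\<dots> \<le> ennreal ((1 / N) ^ N)"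
      using amgm by (rule ennreal_leI)
    finally show "emeasure (power_measure Q N) {y} \<le> ennreal ((1 / N) ^ N)" .
  qed
  have "emeasure (power_measure Q N) (rearrangements N z)
      = (\<Sum>y\<in>rearrangements N z. emeasure (power_measure Q N) {y})"
    using point(1) by (intro emeasure_eq_sum_singleton finite_rearrangements)
  \<comment> \<open>An upper bound for the size of the orbit suffices: it is an image of the
    \<open>N!\<close> permutations.\<close>
  also have "\<dots> \<le> of_nat (card (rearrangements N z)) * ennreal ((1 / N) ^ N)"
    using point(2) by (intro sum_bounded_above)
  also have "\<dots> \<le> of_nat (fact N) * ennreal ((1 / N) ^ N)"
    using card_image_le[of "{p. p permutes ?I}" "\<lambda>p. z \<circ> p"] card_permutations[of ?I N]
    by (intro mult_right_mono of_nat_mono) (auto simp: rearrangements_def finite_permutations)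
  also have "\<dots> = ennreal (fact N / real N ^ N)"
    by (simp add: ennreal_of_nat_eq_real_of_nat ennreal_mult'[symmetric] power_one_over)
  finally show "emeasure (power_measure Q N) (rearrangements N z) \<le> ennreal (fact N / real N ^ N)" .
qed

section \<open>Indicators, points with distinct coordinates, and tightness\<close>

lemma exch_expectation_indicator:
  assumes "B \<in> sets (power_measure Z N)"
  shows "exch_expectation Z N (indicator B) = exch_prob Z N B"
  unfolding exch_expectation_def exch_prob_def using assms
  by (intro SUP_cong refl)
     (auto simp: exchangeable_measures_def space_prob_algebra ennreal_indicator)

lemma iid_expectation_indicator:
  assumes "B \<in> sets (power_measure Z N)"
  shows "iid_expectation Z N (indicator B) = iid_prob Z N B"
proof -
  \<comment> \<open>The integral runs over the power of \<open>Q\<close>, so \<open>B\<close> has to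
    be measurable there as well.\<close>
  have "sets (power_measure Q N) = sets (power_measure Z N)" if "Q \<in> space (prob_algebra Z)" for Q
    using that by (intro sets_PiM_cong) (auto simp: space_prob_algebra)
  with assms show ?thesis
    unfolding iid_expectation_def iid_prob_def
    by (intro SUP_cong refl) (auto simp: ennreal_indicator)
qed

text \<open>The point enumerates \<open>N\<close> distinct elements of the space. The infinite case
  is a separate disjunct because \<open>card\<close> is 0 on infinite sets.\<close>

lemma ex_injective_point:
  assumes "infinite (space Z) \<or> N \<le> card (space Z)"
  shows "\<exists>z \<in> space (power_measure Z N). inj_on z {..<N}"
proof -
  obtain T where T: "T \<subseteq> space Z" "finite T" "card T = N"
    using assms infinite_arbitrarily_large obtain_subset_with_card_n by metis
  obtain h where h: "bij_betw h {..<N} T"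
    using T ex_bij_betw_nat_finite[of T] by (auto simp: atLeast0LessThan)
  show ?thesis
  proof (rule bexI[of _ "restrict h {..<N}"])
    show "inj_on (restrict h {..<N}) {..<N}"
      using h by (simp add: bij_betw_def inj_on_restrict_eq)
    show "restrict h {..<N} \<in> space (power_measure Z N)"
      using h T by (auto simp: space_PiM bij_betw_def)
  qed
qed

theorem proposition5:
  fixes Z :: "'a measure" and N :: nat
  assumes "is_borel_space Z"
    and "space Z \<noteq> {}"
    and "\<forall>z \<in> space Z. {z} \<in> sets Z"
    and "N \<ge> 1"
  shows "(\<forall>F :: (nat \<Rightarrow> 'a) \<Rightarrow> real.
            F \<in> borel_measurable (power_measure Z N) \<longrightarrow>
            (\<forall>z \<in> space (power_measure Z N). 0 \<le> F z) \<longrightarrow>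
            exch_expectation Z N F
              \<le> ennreal (real N ^ N / fact N) * iid_expectation Z N F) \<and>
         (infinite (space Z) \<or> N \<le> card (space Z) \<longrightarrow>
            (\<exists>B \<in> sets (power_measure Z N). B \<noteq> {} \<and>
               exch_expectation Z N (indicator B)
                 = ennreal (real N ^ N / fact N) * iid_expectation Z N (indicator B)) \<and>
            (\<exists>A \<in> sets (power_measure Z N).
               iid_prob Z N A = ennreal (fact N / real N ^ N) \<and>
               ennreal (fact N / real N ^ N) \<le> 1 \<and>
               1 = exch_prob Z N A))"
proof (intro conjI allI impI)
  fix F :: "(nat \<Rightarrow> 'a) \<Rightarrow> real"
  assume "F \<in> borel_measurable (power_measure Z N)"
  then show "exch_expectation Z N F \<le> ennreal (real N ^ N / fact N) * iid_expectation Z N F"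
    using assms(4) by (rule exch_expectation_le[rotated])
next
  assume "infinite (space Z) \<or> N \<le> card (space Z)"
  then obtain z where z: "z \<in> space (power_measure Z N)" and inj: "inj_on z {..<N}"
    using ex_injective_point by blast
  let ?A = "rearrangements N z"
  let ?c = "ennreal (real N ^ N / fact N)"
  have A: "?A \<in> sets (power_measure Z N)"
    using assms(3) z by (rule rearrangements_in_sets)
  have A_ne: "?A \<noteq> {}"
    unfolding rearrangements_def using permutes_id by blast
  have exch: "exch_prob Z N ?A = 1"
    using assms(3) z by (rule exch_prob_rearrangements)
  have "indicator ?A \<in> borel_measurable (power_measure Z N)"
    using A by (rule borel_measurable_indicator)
  \<comment> \<open>The lower bound on the i.i.d. probability needs no explicit \<open>Q\<close>: it
    is the general inequality applied to the indicator of \<open>?A\<close>, whose exchangeable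
    probability is 1.\<close>
  from exch_expectation_le[OF assms(4) this] have one_le: "1 \<le> ?c * iid_prob Z N ?A"
    by (simp add: exch_expectation_indicator[OF A] iid_expectation_indicator[OF A] exch)
  have inverse: "ennreal (fact N / real N ^ N) * ?c = 1"
    using assms(4) by (simp add: ennreal_mult'[symmetric])
  have iid: "iid_prob Z N ?A = ennreal (fact N / real N ^ N)"
  proof (rule antisym)
    show "iid_prob Z N ?A \<le> ennreal (fact N / real N ^ N)"
      using assms(3) z inj by (rule iid_prob_rearrangements_le)
    have "ennreal (fact N / real N ^ N) * 1
        \<le> ennreal (fact N / real N ^ N) * (?c * iid_prob Z N ?A)"
      using one_le by (rule mult_left_mono) simp
    then show "ennreal (fact N / real N ^ N) \<le> iid_prob Z N ?A"
      by (simp add: mult.assoc[symmetric] inverse)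
  qed
  have "(fact N :: real) \<le> real N ^ N"
    using fact_le_power[of N, where 'a = real] by simp
  then have le_1: "ennreal (fact N / real N ^ N) \<le> 1"
    using assms(4) by (simp add: ennreal_le_1 divide_le_eq_1)
  \<comment> \<open>The same orbit serves as \<open>B\<close> and as \<open>A\<close>: both sides of
    the equation equal 1.\<close>
  show "\<exists>B \<in> sets (power_measure Z N). B \<noteq> {} \<and>
      exch_expectation Z N (indicator B) = ?c * iid_expectation Z N (indicator B)"
  proof (intro bexI conjI)
    show "exch_expectation Z N (indicator ?A) = ?c * iid_expectation Z N (indicator ?A)"
      using inverse
      by (simp only: exch_expectation_indicator[OF A] iid_expectation_indicator[OF A] exch iid
          mult.commute[of ?c])
  qed (fact A_ne A)+
  show "\<exists>A \<in> sets (power_measure Z N). iid_prob Z N A = ennreal (fact N / real N ^ N) \<and>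
      ennreal (fact N / real N ^ N) \<le> 1 \<and> 1 = exch_prob Z N A"
    using A iid le_1 exch by auto
qed

end
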